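(* For a combinatorial auction with $m\ge2$ items and $n\ge2$ bidders with additive valuations, there is no randomized mechanism that is universally obviously strategy-proof, satisfies individual rationality and no negative transfers, and gives an approximation better than $\frac{8}{7}$ to the optimal social welfare; i.e., every such mechanism has $\sup_{v}\mathrm{OPT}(v)/\mathbb{E}[W(v)]\ge 8/7$.
   Context: A valuation $v_i:2^M\to\mathbb{R}_{\ge 0}$ is additive if $v_i(A)=\sum_{j\in A}v_{ij}$ for some $v_{ij}\ge0$. Each bidder's domain $V_i$ is the set of additive valuations (publicly known), valuations are private, utilities quasi-linear. A deterministic mechanism is a rooted tree: each internal node is assigned to one bidder, who sends one of the messages labeling the outgoing edges; each leaf is labeled with a feasible allocation (disjoint bundles) and a payment for each bidder. A behavior $B_i$ specifies a message at every node of bidder $i$; a profile $B$ determines a root-to-leaf path $\mathrm{Path}(B)$ with bundle $f_i(B)$ and payment $p_i(B)$ for $i$. A strategy $\mathcal S_i$ maps each $v_i\in V_i$ to a behavior; it is obviously dominant if for every $v_i\in V_i$, every node $u$ of $i$, every $B_{-i}$ and every profile $B'$ with $u\in\mathrm{Path}(\mathcal S_i(v_i),B_{-i})\cap\mathrm{Path}(B')$ and $B'_i$ sending at $u$ a message different from $\mathcal S_i(v_i)$'s, $v_i(f_i(\mathcal S_i(v_i),B_{-i}))-p_i(\mathcal S_i(v_i),B_{-i})\ge v_i(f_i(B'))-p_i(B')$. A randomized mechanism is a probability distribution over deterministic mechanisms each equipped with strategies; it is universally OSP if all strategies in every mechanism of its support are obviously dominant. Individual rationality: in every mechanism of the support,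 for every profile in $\prod_i V_i$, following the strategies gives each bidder utility $\ge0$. No negative transfers: every payment at every leaf of every mechanism in the support is $\ge 0$. $\mathbb{E}[W(v)]$ is the expected welfare of the allocation reached when bidders follow their strategies on profile $v$; $\mathrm{OPT}(v)$ is the optimal welfare. *)

theory Defs
  imports "HOL-Probability.Probability"
begin

text \<open>Bidders are 0..<n, items are 0..<m.  An additive valuation of a bidder is
  represented by its vector of item values (nat \<Rightarrow> real), nonnegative on the items
  and 0 outside the item set (canonical representation).\<close>

definition additive_vals :: "nat \<Rightarrow> (nat \<Rightarrow> real) set" where
  "additive_vals m = {w. (\<forall>j<m. 0 \<le> w j) \<and> (\<forall>j\<ge>m. w j = 0)}"

definition bval :: "(nat \<Rightarrow> real) \<Rightarrow> nat set \<Rightarrow> real" where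
  "bval w A = (\<Sum>j\<in>A. w j)"

definition profiles :: "nat \<Rightarrow> nat \<Rightarrow> (nat \<Rightarrow> nat \<Rightarrow> real) set" where
  "profiles n m = {v. \<forall>i<n. v i \<in> additive_vals m}"

definition feasible :: "nat \<Rightarrow> nat \<Rightarrow> (nat \<Rightarrow> nat set) \<Rightarrow> bool" where
  "feasible n m A \<longleftrightarrow> (\<forall>i<n. A i \<subseteq> {..<m}) \<and>
     (\<forall>i<n. \<forall>k<n. i \<noteq> k \<longrightarrow> A i \<inter> A k = {})"

definition welfare :: "nat \<Rightarrow> (nat \<Rightarrow> nat \<Rightarrow> real) \<Rightarrow> (nat \<Rightarrow> nat set) \<Rightarrow> real" where
  "welfare n v A = (\<Sum>i<n. bval (v i) (A i))"

definition OPT :: "nat \<Rightarrow> nat \<Rightarrow> (nat \<Rightarrow> nat \<Rightarrow> real) \<Rightarrow> real" where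
  "OPT n m v = Max {welfare n v A | A. feasible n m A}"

text \<open>Deterministic mechanisms: rooted trees. A leaf carries an allocation (bundle of
  each bidder) and payments; an internal node is assigned to a bidder, carries the set of
  messages labelling its outgoing edges, and a child for each message.  Nodes are
  identified by the sequence of messages from the root (their history).\<close>
datatype 'msg mech =
    Leaf "nat \<Rightarrow> nat set" "nat \<Rightarrow> real"
  | Node nat "'msg set" "'msg \<Rightarrow> 'msg mech"

fun node_at :: "'msg mech \<Rightarrow> 'msg list \<Rightarrow> 'msg mech option" where
  "node_at T [] = Some T"
| "node_at (Leaf A p) (x # xs) = None"
| "node_at (Node i Ms c) (x # xs) = (if x \<in> Ms then node_at (c x) xs else None)"

definition wf_mech :: "nat \<Rightarrow> nat \<Rightarrow> 'msg mech \<Rightarrow> bool" where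
  "wf_mech n m T \<longleftrightarrow>
     (\<forall>h i Ms c. node_at T h = Some (Node i Ms c) \<longrightarrow> i < n \<and> Ms \<noteq> {}) \<and>
     (\<forall>h A p. node_at T h = Some (Leaf A p) \<longrightarrow> feasible n m A)"

definition no_neg_transfers :: "nat \<Rightarrow> 'msg mech \<Rightarrow> bool" where
  "no_neg_transfers n T \<longleftrightarrow>
     (\<forall>h A p. node_at T h = Some (Leaf A p) \<longrightarrow> (\<forall>i<n. 0 \<le> p i))"

text \<open>A behavior of a bidder maps (the history of) each node to a message; it is valid
  for bidder i if at every node of i it sends one of the messages of that node.\<close>
type_synonym 'msg behavior = "'msg list \<Rightarrow> 'msg"

definition valid_behavior :: "'msg mech \<Rightarrow> nat \<Rightarrow> 'msg behavior \<Rightarrow> bool" where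
  "valid_behavior T i b \<longleftrightarrow> (\<forall>h Ms c. node_at T h = Some (Node i Ms c) \<longrightarrow> b h \<in> Ms)"

definition valid_profile :: "nat \<Rightarrow> 'msg mech \<Rightarrow> (nat \<Rightarrow> 'msg behavior) \<Rightarrow> bool" where
  "valid_profile n T B \<longleftrightarrow> (\<forall>i<n. valid_behavior T i (B i))"

primrec outcome_from :: "'msg mech \<Rightarrow> (nat \<Rightarrow> 'msg behavior) \<Rightarrow> 'msg list
    \<Rightarrow> (nat \<Rightarrow> nat set) \<times> (nat \<Rightarrow> real)" where
  "outcome_from (Leaf A p) B h = (A, p)"
| "outcome_from (Node i Ms c) B h = outcome_from (c (B i h)) B (h @ [B i h])"

definition outcome :: "'msg mech \<Rightarrow> (nat \<Rightarrow> 'msg behavior) \<Rightarrow> (nat \<Rightarrow> nat set) \<times> (nat \<Rightarrow> real)" where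
  "outcome T B = outcome_from T B []"

primrec visits_from :: "'msg mech \<Rightarrow> (nat \<Rightarrow> 'msg behavior) \<Rightarrow> 'msg list \<Rightarrow> 'msg list set" where
  "visits_from (Leaf A p) B h = {}"
| "visits_from (Node i Ms c) B h = insert h (visits_from (c (B i h)) B (h @ [B i h]))"

definition visits :: "'msg mech \<Rightarrow> (nat \<Rightarrow> 'msg behavior) \<Rightarrow> 'msg list set" where
  "visits T B = visits_from T B []"

definition utility :: "'msg mech \<Rightarrow> (nat \<Rightarrow> 'msg behavior) \<Rightarrow> nat \<Rightarrow> (nat \<Rightarrow> real) \<Rightarrow> real" where
  "utility T B i w = bval w (fst (outcome T B) i) - snd (outcome T B) i"

type_synonym 'msg strategies = "nat \<Rightarrow> (nat \<Rightarrow> real) \<Rightarrow> 'msg behavior"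

definition valid_strategies :: "nat \<Rightarrow> nat \<Rightarrow> 'msg mech \<Rightarrow> 'msg strategies \<Rightarrow> bool" where
  "valid_strategies n m T S \<longleftrightarrow> (\<forall>i<n. \<forall>w\<in>additive_vals m. valid_behavior T i (S i w))"

definition obviously_dominant :: "nat \<Rightarrow> nat \<Rightarrow> 'msg mech \<Rightarrow> 'msg strategies \<Rightarrow> nat \<Rightarrow> bool" where
  "obviously_dominant n m T S i \<longleftrightarrow>
     (\<forall>w\<in>additive_vals m. \<forall>u Ms c B B'.
        node_at T u = Some (Node i Ms c) \<longrightarrow>
        valid_profile n T B \<longrightarrow> valid_profile n T B' \<longrightarrow>
        B i = S i w \<longrightarrow>
        u \<in> visits T B \<longrightarrow> u \<in> visits T B' \<longrightarrow>
        B' i u \<noteq> S i w u \<longrightarrow>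
        utility T B' i w \<le> utility T B i w)"

definition indiv_rational :: "nat \<Rightarrow> nat \<Rightarrow> 'msg mech \<Rightarrow> 'msg strategies \<Rightarrow> bool" where
  "indiv_rational n m T S \<longleftrightarrow>
     (\<forall>v\<in>profiles n m. \<forall>i<n. 0 \<le> utility T (\<lambda>k. S k (v k)) i (v i))"

definition mech_welfare :: "nat \<Rightarrow> 'msg mech \<times> 'msg strategies \<Rightarrow> (nat \<Rightarrow> nat \<Rightarrow> real) \<Rightarrow> real" where
  "mech_welfare n D v = welfare n v (fst (outcome (fst D) (\<lambda>k. snd D k (v k))))"

definition good_det_mech :: "nat \<Rightarrow> nat \<Rightarrow> 'msg mech \<times> 'msg strategies \<Rightarrow> bool" where
  "good_det_mech n m D \<longleftrightarrow>
     wf_mech n m (fst D) \<and> valid_strategies n m (fst D) (snd D) \<and>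
     (\<forall>i<n. obviously_dominant n m (fst D) (snd D) i) \<and>
     indiv_rational n m (fst D) (snd D) \<and> no_neg_transfers n (fst D)"

end

theory Submission
  imports Defs
begin

text \<open>Only two bidders and two items matter, each of the bidders \<open>i\<close> and \<open>k\<close> owning the item of
  the same name. With a large parameter \<open>K\<close>, a bidder values (its own item, the other item) at
  \<open>(1, 0)\<close> (low), \<open>(3, K)\<close> (mid) or \<open>(2K, K + 1)\<close> (high). By averaging, it suffices to bound the
  welfare of a deterministic mechanism on the profiles (low, low), (mid, high) and (high, mid),
  weighted by \<open>3K + 1\<close>, \<open>3\<close> and \<open>3\<close>. If it is nearly optimal on all three, then a low bidder gets
  its own item at a price of at most 1 by individual rationality, a high bidder gets both items
  and a mid bidder gets nothing, not even a transfer. Consider the first node at which the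
  messages on the three profiles are not all the same. If mid separates from low there, then mid,
  who may end up with nothing, would rather imitate low. Otherwise high separates from both; not
  imitating low requires high to pay at most \<open>K + 2\<close> for the two items, which mid values at \<open>K +
  3\<close>, so mid would rather imitate high. If there is no such node, the allocation is constant.
  Hence at least one profile loses about 1/8 of the total weighted optimum.\<close>

section \<open>Additive valuations and welfare\<close>

lemma zero_in_additive_vals: "(\<lambda>_. 0) \<in> additive_vals m"
  by (simp add: additive_vals_def)

lemma fun_upd_in_additive_vals:
  assumes "w \<in> additive_vals m" "j < m" "0 \<le> a"
  shows "w(j := a) \<in> additive_vals m"
  using assms by (simp add: additive_vals_def)

lemma zero_in_profiles: "(\<lambda>_ _. 0) \<in> profiles n m"
  by (simp add: profiles_def zero_in_additive_vals)

lemma fun_upd_in_profiles: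
  assumes "v \<in> profiles n m" "w \<in> additive_vals m"
  shows "v(i := w) \<in> profiles n m"
  using assms by (simp add: profiles_def)

lemma bval_zero: "bval (\<lambda>_. 0) A = 0"
  by (simp add: bval_def)

lemma bval_fun_upd:
  assumes "finite A"
  shows "bval (w(j := a)) A = bval w A + (if j \<in> A then a - w j else 0)"
proof -
  have "bval (w(j := a)) A = (\<Sum>l\<in>A. w l + (if l = j then a - w j else 0))"
    unfolding bval_def by (intro sum.cong) auto
  with assms show ?thesis by (simp add: sum.distrib bval_def)
qed

lemma bval_nonneg:
  assumes "w \<in> additive_vals m" "A \<subseteq> {..<m}"
  shows "0 \<le> bval w A"
  using assms by (auto simp: bval_def additive_vals_def intro!: sum_nonneg)

lemma welfare_zero: "welfare n (\<lambda>_ _. 0) A = 0"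
  by (simp add: welfare_def bval_zero)

lemma welfare_fun_upd:
  assumes "i < n"
  shows "welfare n (v(i := w)) A = welfare n v A + bval w (A i) - bval (v i) (A i)"
proof -
  have "welfare n (v(i := w)) A
      = (\<Sum>l<n. bval (v l) (A l) + (if l = i then bval w (A i) - bval (v i) (A i) else 0))"
    unfolding welfare_def by (intro sum.cong) auto
  with assms show ?thesis by (simp add: sum.distrib welfare_def)
qed

lemma feasible_disjoint:
  assumes "feasible n m A" "i < n" "k < n" "i \<noteq> k" "j \<in> A i"
  shows "j \<notin> A k"
  using assms unfolding feasible_def by blast

lemma finite_bundle:
  assumes "feasible n m A" "i < n"
  shows "finite (A i)"
proof (rule finite_subset)
  show "A i \<subseteq> {..<m}" using assms by (simp add: feasible_def)
qed simp

lemma welfare_nonneg: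
  assumes "v \<in> profiles n m" "feasible n m A"
  shows "0 \<le> welfare n v A"
  using assms unfolding welfare_def feasible_def profiles_def
  by (intro sum_nonneg bval_nonneg[where m = m]) auto

lemma finite_feasible_welfare: "finite {welfare n v A | A. feasible n m A}"
proof (rule finite_subset)
  show "{welfare n v A | A. feasible n m A} \<subseteq> welfare n v ` (PiE {..<n} (\<lambda>_. Pow {..<m}))"
  proof clarify
    fix A assume "feasible n m A"
    then have "restrict A {..<n} \<in> PiE {..<n} (\<lambda>_. Pow {..<m})"
      by (auto simp: feasible_def)
    moreover have "welfare n v A = welfare n v (restrict A {..<n})"
      unfolding welfare_def by (intro sum.cong) auto
    ultimately show "welfare n v A \<in> welfare n v ` (PiE {..<n} (\<lambda>_. Pow {..<m}))" by blast
  qed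
qed (auto intro: finite_PiE)

lemma welfare_le_OPT:
  assumes "feasible n m A"
  shows "welfare n v A \<le> OPT n m v"
  unfolding OPT_def using assms by (intro Max_ge finite_feasible_welfare) blast

lemma OPT_eqI:
  assumes "feasible n m A" "\<And>A'. feasible n m A' \<Longrightarrow> welfare n v A' \<le> welfare n v A"
  shows "OPT n m v = welfare n v A"
  unfolding OPT_def using assms by (intro Max_eqI finite_feasible_welfare) auto

section \<open>Runs of a mechanism\<close>

lemma outcome_from_is_leaf:
  assumes "\<And>r j Ms c. node_at T r = Some (Node j Ms c) \<Longrightarrow> B j (h @ r) \<in> Ms"
  shows "\<exists>r A p. node_at T r = Some (Leaf A p) \<and> outcome_from T B h = (A, p)"
  using assms
proof (induction T arbitrary: h)
  case (Leaf A p)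
  have "node_at (Leaf A p) [] = Some (Leaf A p)" by simp
  then show ?case by fastforce
next
  case (Node i Ms c)
  have msg: "B i h \<in> Ms" using Node.prems[of "[]"] by simp
  have "\<exists>r A p. node_at (c (B i h)) r = Some (Leaf A p) \<and>
      outcome_from (c (B i h)) B (h @ [B i h]) = (A, p)"
  proof (rule Node.IH)
    fix r j Ms' c' assume "node_at (c (B i h)) r = Some (Node j Ms' c')"
    then show "B j ((h @ [B i h]) @ r) \<in> Ms'"
      using Node.prems[of "B i h # r"] msg by simp
  qed simp
  then obtain r A p where "node_at (c (B i h)) r = Some (Leaf A p)"
    "outcome_from (c (B i h)) B (h @ [B i h]) = (A, p)" by blast
  then show ?case using msg by (intro exI[of _ "B i h # r"]) simp
qed

lemma outcome_from_eq_if_no_divergence: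
  assumes "B \<in> X" "B' \<in> X"
    and "\<And>C r j Ms c. C \<in> X \<Longrightarrow> node_at T r = Some (Node j Ms c) \<Longrightarrow> C j (h @ r) \<in> Ms"
    and "\<And>C C' r j Ms c. C \<in> X \<Longrightarrow> C' \<in> X \<Longrightarrow> node_at T r = Some (Node j Ms c) \<Longrightarrow>
      \<forall>C\<in>X. h @ r \<in> visits_from T C h \<Longrightarrow> C j (h @ r) = C' j (h @ r)"
  shows "outcome_from T B h = outcome_from T B' h"
  using assms(3,4)
proof (induction T arbitrary: h)
  case (Leaf A p)
  show ?case by simp
next
  case (Node i Ms c)
  let ?x = "B i h"
  have same: "C i h = ?x" if "C \<in> X" for C
    using Node.prems(2)[OF that \<open>B \<in> X\<close>, of "[]"] by simp
  have msg: "?x \<in> Ms" using Node.prems(1)[OF \<open>B \<in> X\<close>, of "[]"] by simp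
  have "outcome_from (c ?x) B (h @ [?x]) = outcome_from (c ?x) B' (h @ [?x])"
  proof (rule Node.IH)
    fix C r j Ms' c' assume "C \<in> X" "node_at (c ?x) r = Some (Node j Ms' c')"
    then show "C j ((h @ [?x]) @ r) \<in> Ms'"
      using Node.prems(1)[of C "?x # r"] msg by simp
  next
    fix C C' r j Ms' c'
    assume "C \<in> X" "C' \<in> X" "node_at (c ?x) r = Some (Node j Ms' c')"
      "\<forall>C\<in>X. (h @ [?x]) @ r \<in> visits_from (c ?x) C (h @ [?x])"
    then show "C j ((h @ [?x]) @ r) = C' j ((h @ [?x]) @ r)"
      using Node.prems(2)[of C C' "?x # r"] msg same by simp
  qed simp
  then show ?case using same[OF \<open>B' \<in> X\<close>] by simp
qed

lemma valid_profile_message: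
  assumes "wf_mech n m T" "valid_profile n T B" "node_at T u = Some (Node j Ms c)"
  shows "B j u \<in> Ms"
  using assms unfolding wf_mech_def valid_profile_def valid_behavior_def by blast

lemma outcome_is_leaf:
  assumes "wf_mech n m T" "valid_profile n T B"
  obtains u where "node_at T u = Some (Leaf (fst (outcome T B)) (snd (outcome T B)))"
proof -
  have "\<exists>u A p. node_at T u = Some (Leaf A p) \<and> outcome_from T B [] = (A, p)"
    by (rule outcome_from_is_leaf) (simp add: valid_profile_message[OF assms])
  then show thesis using that by (auto simp: outcome_def)
qed

lemma outcome_eq_if_no_divergence:
  assumes "wf_mech n m T" "\<And>C. C \<in> X \<Longrightarrow> valid_profile n T C"
    and "\<And>C C' u j Ms c. C \<in> X \<Longrightarrow> C' \<in> X \<Longrightarrow> node_at T u = Some (Node j Ms c) \<Longrightarrow>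
      \<forall>C\<in>X. u \<in> visits T C \<Longrightarrow> C j u = C' j u"
    and "B \<in> X" "B' \<in> X"
  shows "outcome T B = outcome T B'"
  unfolding outcome_def
proof (rule outcome_from_eq_if_no_divergence[OF assms(4,5)])
  fix C r j Ms c assume "C \<in> X" "node_at T r = Some (Node j Ms c)"
  then show "C j ([] @ r) \<in> Ms"
    using valid_profile_message[OF assms(1) assms(2)] by simp
next
  fix C C' r j Ms c
  assume "C \<in> X" "C' \<in> X" "node_at T r = Some (Node j Ms c)"
    "\<forall>C\<in>X. [] @ r \<in> visits_from T C []"
  then show "C j ([] @ r) = C' j ([] @ r)"
    using assms(3)[of C C' r] by (simp add: visits_def)
qed

section \<open>Truthful play\<close>

locale good_mechanism =
  fixes n m :: nat and T :: "'msg mech" and S :: "'msg strategies"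
  assumes good: "good_det_mech n m (T, S)"
begin

definition truthful :: "(nat \<Rightarrow> nat \<Rightarrow> real) \<Rightarrow> nat \<Rightarrow> 'msg behavior" where
  "truthful v = (\<lambda>i. S i (v i))"

definition allocation :: "(nat \<Rightarrow> nat \<Rightarrow> real) \<Rightarrow> nat \<Rightarrow> nat set" where
  "allocation v = fst (outcome T (truthful v))"

definition payment :: "(nat \<Rightarrow> nat \<Rightarrow> real) \<Rightarrow> nat \<Rightarrow> real" where
  "payment v = snd (outcome T (truthful v))"

definition payoff :: "(nat \<Rightarrow> nat \<Rightarrow> real) \<Rightarrow> nat \<Rightarrow> (nat \<Rightarrow> real) \<Rightarrow> real" where
  "payoff v i w = bval w (allocation v i) - payment v i"

lemma wf: "wf_mech n m T"
  using good by (simp add: good_det_mech_def)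

lemma utility_truthful: "utility T (truthful v) i w = payoff v i w"
  by (simp add: utility_def payoff_def allocation_def payment_def)

lemma mech_welfare_eq: "mech_welfare n (T, S) v = welfare n v (allocation v)"
  by (simp add: mech_welfare_def allocation_def truthful_def)

lemma valid_truthful:
  assumes "v \<in> profiles n m"
  shows "valid_profile n T (truthful v)"
  using assms good
  by (simp add: good_det_mech_def valid_strategies_def valid_profile_def profiles_def truthful_def)

lemma feasible_allocation:
  assumes "v \<in> profiles n m"
  shows "feasible n m (allocation v)"
  unfolding allocation_def
  by (rule outcome_is_leaf[OF wf valid_truthful[OF assms]]) (use wf in \<open>unfold wf_mech_def, blast\<close>)

lemma payment_nonneg:
  assumes "v \<in> profiles n m" "i < n"
  shows "0 \<le> payment v i"
proof -
  have "no_neg_transfers n T" using good by (simp add: good_det_mech_def)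
  then show ?thesis
    using outcome_is_leaf[OF wf valid_truthful[OF assms(1)]] assms(2)
    unfolding payment_def no_neg_transfers_def by metis
qed

lemma payoff_nonneg:
  assumes "v \<in> profiles n m" "i < n"
  shows "0 \<le> payoff v i (v i)"
proof -
  have "indiv_rational n m T S" using good by (simp add: good_det_mech_def)
  then have "0 \<le> utility T (truthful v) i (v i)"
    using assms unfolding indiv_rational_def truthful_def by blast
  then show ?thesis by (simp add: utility_truthful)
qed

lemma mech_welfare_nonneg:
  assumes "v \<in> profiles n m"
  shows "0 \<le> mech_welfare n (T, S) v"
  using assms by (simp add: mech_welfare_eq welfare_nonneg feasible_allocation)

lemma mech_welfare_le_OPT:
  assumes "v \<in> profiles n m"
  shows "mech_welfare n (T, S) v \<le> OPT n m v"
  using assms by (simp add: mech_welfare_eq welfare_le_OPT feasible_allocation)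

lemma no_envy_at_divergence:
  assumes "v \<in> profiles n m" "v' \<in> profiles n m"
    and "node_at T u = Some (Node i Ms c)"
    and "u \<in> visits T (truthful v)" "u \<in> visits T (truthful v')"
    and "truthful v' i u \<noteq> truthful v i u"
  shows "payoff v' i (v i) \<le> payoff v i (v i)"
proof -
  have "i < n" using wf assms(3) unfolding wf_mech_def by blast
  then have "obviously_dominant n m T S i" "v i \<in> additive_vals m"
    using good assms(1) by (simp_all add: good_det_mech_def profiles_def)
  moreover have "truthful v i = S i (v i)" by (simp add: truthful_def)
  ultimately have "utility T (truthful v') i (v i) \<le> utility T (truthful v) i (v i)"
    using assms(3-6) valid_truthful[OF assms(1)] valid_truthful[OF assms(2)]
    unfolding obviously_dominant_def by metis
  then show ?thesis by (simp add: utility_truthful)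
qed

lemma same_message_if_envy:
  assumes "x \<in> profiles n m" "z \<in> profiles n m" "w \<in> profiles n m"
    and "node_at T u = Some (Node i Ms c)"
    and "u \<in> visits T (truthful x)" "u \<in> visits T (truthful z)" "u \<in> visits T (truthful w)"
    and z_envies_x: "payoff z i (z i) < payoff x i (z i)"
    and envy_involving_w:
      "payoff z i (z i) < payoff w i (z i) \<or> payoff w i (w i) < payoff x i (w i)"
  shows "truthful x i u = truthful z i u" "truthful w i u = truthful z i u"
proof -
  show xz: "truthful x i u = truthful z i u"
    using no_envy_at_divergence[OF assms(2,1,4,6,5)] z_envies_x by fastforce
  show "truthful w i u = truthful z i u"
  proof (rule ccontr)
    assume separated: "truthful w i u \<noteq> truthful z i u"
    then have "payoff w i (z i) \<le> payoff z i (z i)"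
      by (rule no_envy_at_divergence[OF assms(2,3,4,6,7)])
    moreover have "payoff x i (w i) \<le> payoff w i (w i)"
      using separated xz by (intro no_envy_at_divergence[OF assms(3,1,4,7,5)]) simp
    ultimately show False using envy_involving_w by linarith
  qed
qed

lemma allocation_eq_if_no_divergence:
  assumes "V \<subseteq> profiles n m" "v \<in> V" "v' \<in> V"
    and "\<And>x y u j Ms c. x \<in> V \<Longrightarrow> y \<in> V \<Longrightarrow> node_at T u = Some (Node j Ms c) \<Longrightarrow>
      \<forall>x\<in>V. u \<in> visits T (truthful x) \<Longrightarrow> truthful x j u = truthful y j u"
  shows "allocation v = allocation v'"
proof -
  have "outcome T (truthful v) = outcome T (truthful v')"
  proof (rule outcome_eq_if_no_divergence[OF wf])
    show "truthful v \<in> truthful ` V" "truthful v' \<in> truthful ` V"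
      using assms(2,3) by simp_all
  next
    fix B assume "B \<in> truthful ` V"
    then show "valid_profile n T B" using assms(1) valid_truthful by blast
  next
    fix B B' u j Ms c
    assume "B \<in> truthful ` V" "B' \<in> truthful ` V" and node: "node_at T u = Some (Node j Ms c)"
      and visits: "\<forall>B\<in>truthful ` V. u \<in> visits T B"
    then obtain x y where "x \<in> V" "B = truthful x" "y \<in> V" "B' = truthful y" by blast
    then show "B j u = B' j u" using assms(4)[of x y u j] node visits by simp
  qed
  then show ?thesis by (simp add: allocation_def)
qed

end

section \<open>From deterministic to randomized mechanisms\<close>

lemma integrable_mech_welfare:
  assumes "prob_space M" "AE D in M. good_det_mech n m D" "v \<in> profiles n m"
    and "(\<lambda>D. mech_welfare n D v) \<in> borel_measurable M"
  shows "integrable M (\<lambda>D. mech_welfare n D v)"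
proof -
  interpret prob_space M by fact
  have bound: "norm (mech_welfare n D v) \<le> OPT n m v" if "good_det_mech n m D" for D
  proof -
    interpret good_mechanism n m "fst D" "snd D" using that by unfold_locales simp
    show ?thesis using mech_welfare_nonneg mech_welfare_le_OPT assms(3) by simp
  qed
  have "AE D in M. norm (mech_welfare n D v) \<le> OPT n m v"
    using assms(2) by eventually_elim (rule bound)
  then show ?thesis by (rule integrable_const_bound) fact
qed

text \<open>The easy direction of Yao's minimax principle.\<close>

lemma exists_bad_profile_if_bad_on_average:
  fixes M :: "('msg mech \<times> 'msg strategies) measure"
  assumes "prob_space M" "AE D in M. good_det_mech n m D"
    and "\<And>v. v \<in> profiles n m \<Longrightarrow> (\<lambda>D. mech_welfare n D v) \<in> borel_measurable M"
    and "V \<subseteq> profiles n m" "\<And>v. v \<in> V \<Longrightarrow> 0 \<le> c v"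
    and deterministic: "\<And>D :: 'msg mech \<times> 'msg strategies. good_det_mech n m D \<Longrightarrow>
      \<alpha> * (\<Sum>v\<in>V. c v * mech_welfare n D v) < (\<Sum>v\<in>V. c v * OPT n m v)"
  shows "\<exists>v\<in>V. \<alpha> * (\<integral>D. mech_welfare n D v \<partial>M) < OPT n m v"
proof (rule ccontr)
  assume "\<not> ?thesis"
  then have good_everywhere: "OPT n m v \<le> \<alpha> * (\<integral>D. mech_welfare n D v \<partial>M)" if "v \<in> V" for v
    using that by (meson not_le)
  interpret prob_space M by fact
  have integrable: "integrable M (\<lambda>D. mech_welfare n D v)" if "v \<in> V" for v
    using that assms by (blast intro: integrable_mech_welfare)
  have "(\<integral>D. \<alpha> * (\<Sum>v\<in>V. c v * mech_welfare n D v) \<partial>M) < (\<Sum>v\<in>V. c v * OPT n m v)"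
  proof (rule expectation_less)
    show "AE D in M. \<alpha> * (\<Sum>v\<in>V. c v * mech_welfare n D v) < (\<Sum>v\<in>V. c v * OPT n m v)"
      using assms(2) by eventually_elim (rule deterministic)
  qed (intro integrable_mult_right Bochner_Integration.integrable_sum integrable)
  also have "\<dots> \<le> (\<Sum>v\<in>V. c v * (\<alpha> * (\<integral>D. mech_welfare n D v \<partial>M)))"
    using assms(5) good_everywhere by (intro sum_mono mult_left_mono)
  also have "\<dots> = (\<integral>D. \<alpha> * (\<Sum>v\<in>V. c v * mech_welfare n D v) \<partial>M)"
    using integrable by (simp add: sum_distrib_left ac_simps)
  finally show False by simp
qed

section \<open>The hard instances\<close>

definition low_val :: "nat \<Rightarrow> nat \<Rightarrow> real" where
  "low_val i = (\<lambda>_. 0)(i := 1)"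

definition mid_val :: "real \<Rightarrow> nat \<Rightarrow> nat \<Rightarrow> nat \<Rightarrow> real" where
  "mid_val K i k = (\<lambda>_. 0)(i := 3, k := K)"

definition high_val :: "real \<Rightarrow> nat \<Rightarrow> nat \<Rightarrow> nat \<Rightarrow> real" where
  "high_val K i k = (\<lambda>_. 0)(i := 2 * K, k := K + 1)"

definition low_profile :: "nat \<Rightarrow> nat \<Rightarrow> nat \<Rightarrow> nat \<Rightarrow> real" where
  "low_profile i k = (\<lambda>_ _. 0)(i := low_val i, k := low_val k)"

definition contest_profile :: "real \<Rightarrow> nat \<Rightarrow> nat \<Rightarrow> nat \<Rightarrow> nat \<Rightarrow> real" where
  "contest_profile K i k = (\<lambda>_ _. 0)(i := mid_val K i k, k := high_val K k i)"

definition hard_profiles :: "real \<Rightarrow> nat \<Rightarrow> nat \<Rightarrow> (nat \<Rightarrow> nat \<Rightarrow> real) set" where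
  "hard_profiles K i k = {low_profile i k, contest_profile K i k, contest_profile K k i}"

definition hard_weight :: "real \<Rightarrow> nat \<Rightarrow> nat \<Rightarrow> (nat \<Rightarrow> nat \<Rightarrow> real) \<Rightarrow> real" where
  "hard_weight K i k v = (if v = low_profile i k then 3 * K + 1 else 3)"

definition nearly_optimal :: "nat \<Rightarrow> real \<Rightarrow> nat \<Rightarrow> nat \<Rightarrow> 'msg mech \<times> 'msg strategies \<Rightarrow> bool" where
  "nearly_optimal n K i k D \<longleftrightarrow> 1 < mech_welfare n D (low_profile i k) \<and>
     2 * K + 3 < mech_welfare n D (contest_profile K i k) \<and>
     2 * K + 3 < mech_welfare n D (contest_profile K k i)"

lemma low_profile_commute: "low_profile i k = low_profile k i"
  by (auto simp: low_profile_def fun_eq_iff)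

lemma hard_profiles_commute: "hard_profiles K i k = hard_profiles K k i"
  unfolding hard_profiles_def low_profile_commute[of k i] by blast

lemma nearly_optimal_commute: "nearly_optimal n K i k D \<longleftrightarrow> nearly_optimal n K k i D"
  unfolding nearly_optimal_def low_profile_commute[of k i] by blast

lemma hard_profiles_other_bidder:
  assumes "v \<in> hard_profiles K i k" "j \<noteq> i" "j \<noteq> k"
  shows "v j = (\<lambda>_. 0)"
  using assms by (auto simp: hard_profiles_def low_profile_def contest_profile_def)

locale hard_instances =
  fixes n m i k :: nat and K :: real
  assumes bidders: "i < n" "k < n" and items: "i < m" "k < m"
    and distinct: "i \<noteq> k" and K_ge_2: "2 \<le> K"
begin

lemma low_profile_in_profiles: "low_profile i k \<in> profiles n m"
  unfolding low_profile_def low_val_def using items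
  by (intro fun_upd_in_profiles fun_upd_in_additive_vals zero_in_profiles zero_in_additive_vals)
    auto

lemma contest_profile_in_profiles: "contest_profile K i k \<in> profiles n m"
  unfolding contest_profile_def mid_val_def high_val_def using items K_ge_2
  by (intro fun_upd_in_profiles fun_upd_in_additive_vals zero_in_profiles zero_in_additive_vals)
    auto

lemma welfare_low_profile:
  assumes "feasible n m A"
  shows "welfare n (low_profile i k) A = (if i \<in> A i then 1 else 0) + (if k \<in> A k then 1 else 0)"
  using assms bidders distinct
  by (simp add: low_profile_def low_val_def welfare_fun_upd welfare_zero bval_fun_upd bval_zero
      finite_bundle)

lemma welfare_contest_profile:
  assumes "feasible n m A"
  shows "welfare n (contest_profile K i k) A =
    (if i \<in> A i then 3 else 0) + (if k \<in> A i then K else 0) +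
    (if k \<in> A k then 2 * K else 0) + (if i \<in> A k then K + 1 else 0)"
  using assms bidders distinct
  by (simp add: contest_profile_def mid_val_def high_val_def welfare_fun_upd welfare_zero
      bval_fun_upd bval_zero finite_bundle)

lemma low_profile_bundles:
  assumes "feasible n m A" "1 < welfare n (low_profile i k) A"
  shows "i \<in> A i" "k \<notin> A i"
  using assms(2) feasible_disjoint[OF assms(1), of k i k] bidders distinct
  by (auto simp: welfare_low_profile[OF assms(1)] split: if_splits)

lemma contest_profile_bundles:
  assumes "feasible n m A" "2 * K + 3 < welfare n (contest_profile K i k) A"
  shows "i \<notin> A i" "k \<notin> A i" "i \<in> A k" "k \<in> A k"
proof -
  have "j \<notin> A i \<or> j \<notin> A k" for j
    using feasible_disjoint[OF assms(1)] bidders distinct by blast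
  from this[of i] this[of k] show "i \<notin> A i" "k \<notin> A i" "i \<in> A k" "k \<in> A k"
    using assms(2) K_ge_2 by (auto simp: welfare_contest_profile[OF assms(1)] split: if_splits)
qed

lemma OPT_low_profile: "OPT n m (low_profile i k) = 2"
proof -
  define A where "A = (\<lambda>_. {} :: nat set)(i := {i}, k := {k})"
  have feasible_A: "feasible n m A" using items distinct by (auto simp: A_def feasible_def)
  then have "welfare n (low_profile i k) A = 2"
    using distinct by (simp add: welfare_low_profile A_def)
  then show ?thesis
    using OPT_eqI[OF feasible_A, of "low_profile i k"] by (simp add: welfare_low_profile)
qed

lemma OPT_contest_profile: "OPT n m (contest_profile K i k) = 3 * K + 1"
proof -
  define A where "A = (\<lambda>_. {} :: nat set)(k := {i, k})"
  have feasible_A: "feasible n m A" using items by (auto simp: A_def feasible_def)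
  then have welfare_A: "welfare n (contest_profile K i k) A = 3 * K + 1"
    using distinct by (simp add: welfare_contest_profile A_def)
  have "welfare n (contest_profile K i k) A' \<le> 3 * K + 1" if feasible_A': "feasible n m A'" for A'
  proof -
    have "j \<notin> A' i \<or> j \<notin> A' k" for j
      using feasible_disjoint[OF feasible_A'] bidders distinct by blast
    from this[of i] this[of k] show ?thesis
      using K_ge_2 by (auto simp: welfare_contest_profile[OF feasible_A'])
  qed
  then show ?thesis using OPT_eqI[OF feasible_A] welfare_A by simp
qed

lemma hard_instances_commute: "hard_instances n m k i K"
  using bidders items distinct K_ge_2 by unfold_locales auto

lemma hard_profiles_subset_profiles: "hard_profiles K i k \<subseteq> profiles n m"
  using low_profile_in_profiles contest_profile_in_profiles
    hard_instances.contest_profile_in_profiles[OF hard_instances_commute]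
  by (simp add: hard_profiles_def)

lemma sum_hard_profiles:
  "(\<Sum>v\<in>hard_profiles K i k. hard_weight K i k v * f v) = (3 * K + 1) * f (low_profile i k)
    + 3 * f (contest_profile K i k) + 3 * f (contest_profile K k i)"
proof -
  have "low_profile i k i i = 1" "contest_profile K i k i i = 3" "contest_profile K k i i i = 2 * K"
    using distinct by (simp_all add: low_profile_def contest_profile_def low_val_def mid_val_def
        high_val_def)
  then have "low_profile i k \<noteq> contest_profile K i k" "low_profile i k \<noteq> contest_profile K k i"
    "contest_profile K i k \<noteq> contest_profile K k i"
    using K_ge_2 by auto
  then show ?thesis by (auto simp: hard_profiles_def hard_weight_def)
qed

end

section \<open>Deterministic mechanisms lose on a hard instance\<close>

locale mechanism_on_hard_instances = good_mechanism n m T S + hard_instances n m i k K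
  for n m :: nat and T :: "'msg mech" and S :: "'msg strategies" and i k :: nat and K :: real
begin

lemma mechanism_on_hard_instances_commute: "mechanism_on_hard_instances n m T S k i K"
  using good_mechanism_axioms hard_instances_commute by (rule mechanism_on_hard_instances.intro)

lemma envy_at_hard_profiles:
  assumes "nearly_optimal n K i k (T, S)"
  shows "payoff (contest_profile K i k) i (mid_val K i k)
      < payoff (low_profile i k) i (mid_val K i k)"
      (is ?mid_envies_low)
    and "payoff (contest_profile K i k) i (mid_val K i k)
        < payoff (contest_profile K k i) i (mid_val K i k) \<or>
      payoff (contest_profile K k i) i (high_val K i k)
        < payoff (low_profile i k) i (high_val K i k)"
      (is ?mid_envies_high_or_high_envies_low)
proof -
  interpret swapped: hard_instances n m k i K by (rule hard_instances_commute)
  define x z w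
    where "x = low_profile i k" and "z = contest_profile K i k" and "w = contest_profile K k i"
  note xzw = x_def z_def w_def
  have profiles: "x \<in> profiles n m" "z \<in> profiles n m" "w \<in> profiles n m"
    by (simp_all add: xzw low_profile_in_profiles contest_profile_in_profiles
        swapped.contest_profile_in_profiles)
  note feasible = profiles[THEN feasible_allocation]
  have "i \<in> allocation x i" "k \<notin> allocation x i" "i \<notin> allocation z i" "k \<notin> allocation z i"
    "i \<in> allocation w i" "k \<in> allocation w i"
    using assms low_profile_bundles[OF feasible(1)] contest_profile_bundles[OF feasible(2)]
      swapped.contest_profile_bundles[OF feasible(3)]
    by (simp_all add: nearly_optimal_def mech_welfare_eq xzw)
  then have payoffs:
    "payoff x i (low_val i) = 1 - payment x i"
    "payoff x i (mid_val K i k) = 3 - payment x i"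
    "payoff x i (high_val K i k) = 2 * K - payment x i"
    "payoff z i (mid_val K i k) = - payment z i"
    "payoff w i (mid_val K i k) = K + 3 - payment w i"
    "payoff w i (high_val K i k) = 3 * K + 1 - payment w i"
    using feasible[THEN finite_bundle, OF bidders(1)] distinct
    by (simp_all add: payoff_def low_val_def mid_val_def high_val_def bval_fun_upd bval_zero)
  have "x i = low_val i" using distinct by (simp add: x_def low_profile_def)
  then have "payment x i \<le> 1"
    using payoff_nonneg[OF profiles(1) bidders(1)] payoffs(1) by simp
  moreover have "0 \<le> payment z i" by (rule payment_nonneg[OF profiles(2) bidders(1)])
  ultimately have "payoff z i (mid_val K i k) < payoff x i (mid_val K i k)"
    and "payoff z i (mid_val K i k) < payoff w i (mid_val K i k)
      \<or> payoff w i (high_val K i k) < payoff x i (high_val K i k)"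
    unfolding payoffs by linarith+
  then show ?mid_envies_low and ?mid_envies_high_or_high_envies_low
    by (simp_all only: xzw)
qed

lemma same_message_at_common_node:
  assumes "nearly_optimal n K i k (T, S)" "node_at T u = Some (Node i Ms c)"
    and "\<forall>v\<in>hard_profiles K i k. u \<in> visits T (truthful v)" "v \<in> hard_profiles K i k"
  shows "truthful v i u = truthful (contest_profile K i k) i u"
proof -
  have types: "contest_profile K i k i = mid_val K i k" "contest_profile K k i i = high_val K i k"
    using distinct by (simp_all add: contest_profile_def)
  have profiles: "low_profile i k \<in> profiles n m" "contest_profile K i k \<in> profiles n m"
    "contest_profile K k i \<in> profiles n m"
    using hard_profiles_subset_profiles by (simp_all add: hard_profiles_def)
  have "u \<in> visits T (truthful (low_profile i k))" "u \<in> visits T (truthful (contest_profile K i k))"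
    "u \<in> visits T (truthful (contest_profile K k i))"
    using assms(3) by (simp_all add: hard_profiles_def)
  from same_message_if_envy[OF profiles assms(2) this] show ?thesis
    using assms(4) envy_at_hard_profiles[OF assms(1)] unfolding types hard_profiles_def by blast
qed

lemma not_nearly_optimal: "\<not> nearly_optimal n K i k (T, S)"
proof
  assume nearly_optimal: "nearly_optimal n K i k (T, S)"
  interpret swapped: mechanism_on_hard_instances n m T S k i K
    by (rule mechanism_on_hard_instances_commute)
  have "allocation (low_profile i k) = allocation (contest_profile K i k)"
  proof (rule allocation_eq_if_no_divergence[OF hard_profiles_subset_profiles])
    fix x y u j Ms c
    assume xy: "x \<in> hard_profiles K i k" "y \<in> hard_profiles K i k"
      and node: "node_at T u = Some (Node j Ms c)"
      and visits: "\<forall>v\<in>hard_profiles K i k. u \<in> visits T (truthful v)"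
    consider "j = i" | "j = k" | "j \<noteq> i" "j \<noteq> k" by blast
    then show "truthful x j u = truthful y j u"
    proof cases
      assume "j = i"
      then show ?thesis
        using same_message_at_common_node[OF nearly_optimal _ visits] node xy by simp
    next
      assume "j = k"
      then show ?thesis
        using swapped.same_message_at_common_node nearly_optimal node visits xy
        by (simp add: nearly_optimal_commute[of n K k] hard_profiles_commute[of K k])
    next
      assume "j \<noteq> i" "j \<noteq> k"
      then show ?thesis using xy by (simp add: truthful_def hard_profiles_other_bidder)
    qed
  qed (simp_all add: hard_profiles_def)
  moreover have "i \<in> allocation (low_profile i k) i"
    using nearly_optimal low_profile_bundles(1)[OF feasible_allocation[OF low_profile_in_profiles]]
    by (simp add: nearly_optimal_def mech_welfare_eq)
  moreover have "i \<notin> allocation (contest_profile K i k) i"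
    using nearly_optimal
      contest_profile_bundles(1)[OF feasible_allocation[OF contest_profile_in_profiles]]
    by (simp add: nearly_optimal_def mech_welfare_eq)
  ultimately show False by simp
qed

end

context hard_instances
begin

lemma weighted_OPT:
  "(\<Sum>v\<in>hard_profiles K i k. hard_weight K i k v * OPT n m v) = 24 * K + 8"
  unfolding sum_hard_profiles OPT_low_profile OPT_contest_profile
    hard_instances.OPT_contest_profile[OF hard_instances_commute] by simp

lemma weighted_mech_welfare_le:
  assumes "good_det_mech n m D"
  shows "(\<Sum>v\<in>hard_profiles K i k. hard_weight K i k v * mech_welfare n D v) \<le> 21 * K + 14"
proof -
  interpret swapped: hard_instances n m k i K by (rule hard_instances_commute)
  interpret mechanism_on_hard_instances n m "fst D" "snd D" i k K
    using assms by unfold_locales simp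
  have le_OPT: "mech_welfare n D (low_profile i k) \<le> 2"
    "mech_welfare n D (contest_profile K i k) \<le> 3 * K + 1"
    "mech_welfare n D (contest_profile K k i) \<le> 3 * K + 1"
    using mech_welfare_le_OPT[OF low_profile_in_profiles]
      mech_welfare_le_OPT[OF contest_profile_in_profiles]
      mech_welfare_le_OPT[OF swapped.contest_profile_in_profiles]
    by (simp_all add: OPT_low_profile OPT_contest_profile swapped.OPT_contest_profile)
  have scaled: "(3 * K + 1) * mech_welfare n D (low_profile i k) \<le> (3 * K + 1) * b"
    if "mech_welfare n D (low_profile i k) \<le> b" for b
    using that K_ge_2 by (intro mult_left_mono) auto
  consider "mech_welfare n D (low_profile i k) \<le> 1"
    | "mech_welfare n D (contest_profile K i k) \<le> 2 * K + 3"
    | "mech_welfare n D (contest_profile K k i) \<le> 2 * K + 3"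
    using not_nearly_optimal by (auto simp: nearly_optimal_def)
  then show ?thesis
  proof cases
    assume "mech_welfare n D (low_profile i k) \<le> 1"
    from scaled[OF this] show ?thesis unfolding sum_hard_profiles using le_OPT by simp
  qed (use le_OPT scaled[OF le_OPT(1)] K_ge_2 in \<open>simp_all add: sum_hard_profiles\<close>)
qed

lemma weighted_approximation_fails:
  assumes "good_det_mech n m D" "\<alpha> < 8/7" "8 \<le> K * (24 - 21 * \<alpha>)"
  shows "\<alpha> * (\<Sum>v\<in>hard_profiles K i k. hard_weight K i k v * mech_welfare n D v)
    < (\<Sum>v\<in>hard_profiles K i k. hard_weight K i k v * OPT n m v)"
proof -
  interpret good_mechanism n m "fst D" "snd D" using assms(1) by unfold_locales simp
  define W where "W = (\<Sum>v\<in>hard_profiles K i k. hard_weight K i k v * mech_welfare n D v)"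
  have "\<alpha> * W < 24 * K + 8"
  proof (cases "0 \<le> \<alpha>")
    case True
    then have "\<alpha> * W \<le> \<alpha> * (21 * K + 14)"
      unfolding W_def by (intro mult_left_mono weighted_mech_welfare_le assms(1))
    also have "\<dots> < 24 * K + 8" using assms(2,3) by (simp add: algebra_simps)
    finally show ?thesis .
  next
    case False
    have "0 \<le> W"
      using K_ge_2 mech_welfare_nonneg hard_profiles_subset_profiles unfolding W_def
      by (intro sum_nonneg mult_nonneg_nonneg) (auto simp: hard_weight_def)
    with False have "\<alpha> * W \<le> 0" by (simp add: mult_nonpos_nonneg)
    then show ?thesis using K_ge_2 by simp
  qed
  then show ?thesis by (simp add: W_def weighted_OPT)
qed

end

theorem theorem4p4:
  fixes n m :: nat
    and M :: "('msg mech \<times> 'msg strategies) measure"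
  assumes "2 \<le> m" and "2 \<le> n"
    and "prob_space M"
    and "AE D in M. good_det_mech n m D"
    and "\<And>v. v \<in> profiles n m \<Longrightarrow> (\<lambda>D. mech_welfare n D v) \<in> borel_measurable M"
  shows "\<forall>\<alpha>::real. \<alpha> < 8/7 \<longrightarrow>
           (\<exists>v\<in>profiles n m. \<alpha> * (\<integral>D. mech_welfare n D v \<partial>M) < OPT n m v)"
proof (intro allI impI)
  fix \<alpha> :: real
  assume \<alpha>: "\<alpha> < 8/7"
  define K where "K = max 2 (8 / (24 - 21 * \<alpha>))"
  have "8 / (24 - 21 * \<alpha>) \<le> K" by (simp add: K_def)
  with \<alpha> have large: "8 \<le> K * (24 - 21 * \<alpha>)" by (simp add: pos_divide_le_eq)
  interpret hard_instances n m 0 1 K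
    using assms(1,2) by unfold_locales (auto simp: K_def)
  have "\<exists>v\<in>hard_profiles K 0 1. \<alpha> * (\<integral>D. mech_welfare n D v \<partial>M) < OPT n m v"
  proof (rule exists_bad_profile_if_bad_on_average[where c = "hard_weight K 0 1",
        OF assms(3-5) hard_profiles_subset_profiles])
    show "0 \<le> hard_weight K 0 1 v" for v using K_ge_2 by (simp add: hard_weight_def)
  qed (assumption, rule weighted_approximation_fails[OF _ \<alpha> large])
  then show "\<exists>v\<in>profiles n m. \<alpha> * (\<integral>D. mech_welfare n D v \<partial>M) < OPT n m v"
    using hard_profiles_subset_profiles by blast
qed

end
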